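(* Let $\tau$ be an infinite cardinal number. Then $I_\tau$ is a max-plus-convex subfunctor of the functor $I_\beta$ of idempotent probability measures with compact support.
   Context: "Compact" means compact Hausdorff space. For $u,v\in\mathbb{R}\cup\{-\infty\}$ put $u\oplus v=\max\{u,v\}$ and $u\odot v=u+v$; $\mathbb{R}_{\max}=\mathbb{R}\cup\{-\infty\}$ with these operations, zero $\mathbf{0}=-\infty$ and unit $\mathbf{1}=0$. For a compact $K$, let $C(K)$ be the set of continuous real functions on $K$; for $\lambda\in\mathbb{R}$, $\lambda_K$ is the constant function with value $\lambda$; $\lambda\odot\varphi=\varphi+\lambda_K$ and $\varphi\oplus\psi=\max\{\varphi,\psi\}$ (pointwise). An idempotent probability measure on $K$ is a functional $\mu:C(K)\to\mathbb{R}$ such that (i) $\mu(\lambda_K)=\lambda$ for all $\lambda\in\mathbb{R}$; (ii) $\mu(\lambda\odot\varphi)=\lambda\odot\mu(\varphi)$ for all $\lambda\in\mathbb{R}$, $\varphi\in C(K)$; (iii) $\mu(\varphi\oplus\psi)=\mu(\varphi)\oplus\mu(\psi)$ for all $\varphi,\psi\in C(K)$. $I(K)$ is the set of all such $\mu$, with the topology induced from $\mathbb{R}^{C(K)}$. For a continuous map $f:K\to L$ of compacts, $I(f):I(K)\to I(L)$ is given by $I(f)(\mu)(\varphi)=\mu(\varphi\circ f)$. For closed $F\subset K$, $I(F)$ is identified with a subset of $I(K)$ via the inclusion map, and $\operatorname{supp}\mu=\bigcap\{F\subset K: F \text{ closed in } K,\ \mu\in I(F)\}$. For a Tychonoff space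 $X$ with Stone–Čech compactification $\beta X$, $I_\beta(X)=\{\mu\in I(\beta X):\operatorname{supp}\mu\subset X\}$ with the subspace topology. For a continuous map $f:X\to Y$ of Tychonoff spaces with extension $\beta f:\beta X\to\beta Y$, $I(\beta f)$ maps $I_\beta(X)$ into $I_\beta(Y)$, and $I_\beta(f)=I(\beta f)|_{I_\beta(X)}$. Thus $I_\beta$ is a functor on the category $Tych$ of Tychonoff spaces and continuous maps. For a cardinal $\tau$ and a Tychonoff space $X$, $I_\tau(X)=\{\mu\in I_\beta(X):|\operatorname{supp}\mu|<\tau\}$, and for a continuous map $f:X\to Y$, $I_\tau(f)$ is the restriction of $I_\beta(f)$ to $I_\tau(X)$. (That $I_\tau$ is a subfunctor of $I_\beta$ includes that $I_\beta(f)$ maps $I_\tau(X)$ into $I_\tau(Y)$ for each continuous $f:X\to Y$.) A subfunctor $F$ of $I_\beta$ on $Tych$ is max-plus-convex if for every Tychonoff space $X$, all $\mu_1,\mu_2\in F(X)$ and all $\alpha,\beta\in\mathbb{R}_{\max}$ with $\alpha\oplus\beta=\mathbf{1}$ one has $\alpha\odot\mu_1\oplus\beta\odot\mu_2\in F(X)$, where $(\alpha\odot\mu_1\oplus\beta\odot\mu_2)(\varphi)=\max\{\alpha+\mu_1(\varphi),\beta+\mu_2(\varphi)\}$. *)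

theory Defs
  imports "HOL-Analysis.Analysis"
begin

unbundle cardinal_syntax

definition tychonoff_space :: "'a topology \<Rightarrow> bool" where
  "tychonoff_space X \<longleftrightarrow> completely_regular_space X \<and> Hausdorff_space X"

text \<open>Functions on \<open>topspace X\<close> and functionals on sets of such functions are extensional HOL
  functions throughout, so that equality of representatives is equality of functions.
  The Stone-Cech compactification is the closure of the image of \<open>X\<close> in the cube indexed by all
  continuous functions to \<open>[0,1]\<close>.\<close>

definition unit_functions :: "'a topology \<Rightarrow> ('a \<Rightarrow> real) set" where
  "unit_functions X = {f \<in> extensional (topspace X). continuous_map X (top_of_set {0..1}) f}"

definition stone_cech_cube :: "'a topology \<Rightarrow> (('a \<Rightarrow> real) \<Rightarrow> real) topology" where
  "stone_cech_cube X = product_topology (\<lambda>_. top_of_set {0..1}) (unit_functions X)"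

definition stone_cech_emb :: "'a topology \<Rightarrow> 'a \<Rightarrow> (('a \<Rightarrow> real) \<Rightarrow> real)" where
  "stone_cech_emb X x = (\<lambda>f\<in>unit_functions X. f x)"

definition stone_cech :: "'a topology \<Rightarrow> (('a \<Rightarrow> real) \<Rightarrow> real) topology" where
  "stone_cech X = subtopology (stone_cech_cube X)
     (stone_cech_cube X closure_of (stone_cech_emb X ` topspace X))"

definition stone_cech_extends ::
  "'a topology \<Rightarrow> 'b topology \<Rightarrow> ('a \<Rightarrow> 'b) \<Rightarrow>
     ((('a \<Rightarrow> real) \<Rightarrow> real) \<Rightarrow> (('b \<Rightarrow> real) \<Rightarrow> real)) \<Rightarrow> bool" where
  "stone_cech_extends X Y f h \<longleftrightarrow>
     h \<in> extensional (topspace (stone_cech X)) \<and>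
     continuous_map (stone_cech X) (stone_cech Y) h \<and>
     (\<forall>x\<in>topspace X. h (stone_cech_emb X x) = stone_cech_emb Y (f x))"

text \<open>The description is proper for continuous \<open>f\<close> by \<open>stone_cech_extension_unique\<close> below.\<close>

definition stone_cech_map ::
  "'a topology \<Rightarrow> 'b topology \<Rightarrow> ('a \<Rightarrow> 'b) \<Rightarrow>
     (('a \<Rightarrow> real) \<Rightarrow> real) \<Rightarrow> (('b \<Rightarrow> real) \<Rightarrow> real)" where
  "stone_cech_map X Y f = (THE h. stone_cech_extends X Y f h)"

lemma compact_space_stone_cech: "compact_space (stone_cech X)"
proof -
  have "compact_space (stone_cech_cube X)"
    unfolding stone_cech_cube_def
    by (intro iffD2[OF compact_space_product_topology] disjI2 ballI)
       (simp add: compact_space_subtopology compactin_euclidean_iff)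
  then show ?thesis
    unfolding stone_cech_def
    by (intro compact_space_subtopology closedin_compact_space closedin_closure_of)
qed

lemma Hausdorff_space_stone_cech: "Hausdorff_space (stone_cech X)"
  unfolding stone_cech_def stone_cech_cube_def
  by (intro Hausdorff_space_subtopology)
     (simp add: Hausdorff_space_product_topology Hausdorff_space_subtopology)

lemma stone_cech_emb_in_cube:
  "stone_cech_emb X ` topspace X \<subseteq> topspace (stone_cech_cube X)"
proof
  fix p assume "p \<in> stone_cech_emb X ` topspace X"
  then obtain x where "x \<in> topspace X" and p: "p = stone_cech_emb X x" by blast
  then have "f x \<in> {0..1}" if "f \<in> unit_functions X" for f
    using that continuous_map_image_subset_topspace[of X "top_of_set {0..1}" f]
    unfolding unit_functions_def topspace_euclidean_subtopology by blast
  then show "p \<in> topspace (stone_cech_cube X)"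
    unfolding p stone_cech_emb_def stone_cech_cube_def topspace_product_topology
    by (simp add: PiE_iff)
qed

lemma stone_cech_emb_in_closure:
  "stone_cech_emb X ` topspace X
     \<subseteq> stone_cech_cube X closure_of (stone_cech_emb X ` topspace X)"
  by (intro closure_of_subset stone_cech_emb_in_cube)

lemma topspace_stone_cech:
  "topspace (stone_cech X) = stone_cech_cube X closure_of (stone_cech_emb X ` topspace X)"
  unfolding stone_cech_def topspace_subtopology
  using closure_of_subset_topspace by (rule Int_absorb1)

lemma stone_cech_dense:
  "stone_cech X closure_of (stone_cech_emb X ` topspace X) = topspace (stone_cech X)"
  unfolding topspace_stone_cech unfolding stone_cech_def
  by (simp only: closure_of_subtopology Int_absorb1[OF stone_cech_emb_in_closure] Int_absorb)

lemma unit_functions_eq: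
  "unit_functions X =
     mspace (submetric (cfunspace X euclidean_metric) {f. f \<in> topspace X \<rightarrow> {0..1}})"
proof -
  have "bounded (f ` topspace X)" if "f \<in> topspace X \<rightarrow> {0..1::real}" for f
    using that by (intro bounded_subset[OF bounded_closed_interval]) blast
  then show ?thesis
    unfolding unit_functions_def continuous_map_in_subtopology mspace_submetric image_subset_iff_funcset
    by auto
qed

lemma stone_cech_embedding:
  assumes "tychonoff_space X"
  shows "embedding_map X (stone_cech X) (stone_cech_emb X)"
proof -
  have "embedding_map X (stone_cech_cube X) (stone_cech_emb X)"
    using completely_regular_space_cube_embedding_explicit assms
    unfolding tychonoff_space_def stone_cech_cube_def stone_cech_emb_def[abs_def] unit_functions_eq
    by blast
  then show ?thesis
    unfolding stone_cech_def
    by (simp only: embedding_map_in_subtopology stone_cech_emb_in_closure simp_thms)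
qed

lemma stone_cech_extension_unique:
  fixes X :: "'a topology" and Y :: "'b topology"
  assumes f: "continuous_map X Y f"
  shows "\<exists>!h. stone_cech_extends X Y f h"
proof (rule ex_ex1I)
  define h0 :: "(('a \<Rightarrow> real) \<Rightarrow> real) \<Rightarrow> (('b \<Rightarrow> real) \<Rightarrow> real)"
    where "h0 = (\<lambda>p. \<lambda>g\<in>unit_functions Y. p (restrict (g \<circ> f) (topspace X)))"
  have pull: "restrict (g \<circ> f) (topspace X) \<in> unit_functions X" if "g \<in> unit_functions Y" for g
  proof -
    have "continuous_map X (top_of_set {0..1}) (g \<circ> f)"
      using f that unfolding unit_functions_def by (blast intro: continuous_map_compose)
    then have "continuous_map X (top_of_set {0..1}) (restrict (g \<circ> f) (topspace X))"
      by (rule continuous_map_eq) (simp only: restrict_apply')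
    then show ?thesis
      unfolding unit_functions_def by (simp only: mem_Collect_eq restrict_extensional simp_thms)
  qed
  have h0_emb: "h0 (stone_cech_emb X x) = stone_cech_emb Y (f x)" if x: "x \<in> topspace X" for x
  proof
    fix g show "h0 (stone_cech_emb X x) g = stone_cech_emb Y (f x) g"
      using x pull[of g] unfolding h0_def stone_cech_emb_def
      by (cases "g \<in> unit_functions Y") (simp_all only: restrict_apply o_apply if_True if_False)
  qed
  have h0_cont: "continuous_map (stone_cech_cube X) (stone_cech_cube Y) h0"
    unfolding stone_cech_cube_def continuous_map_componentwise
  proof (intro conjI ballI)
    fix g assume g: "g \<in> unit_functions Y"
    show "continuous_map (product_topology (\<lambda>_. top_of_set {0..1}) (unit_functions X))
        (top_of_set {0..1}) (\<lambda>p. h0 p g)"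
      using continuous_map_product_projection[OF pull[OF g], of "\<lambda>_. top_of_set {0..1}"]
      unfolding h0_def restrict_apply'[OF g] .
  next
    show "h0 ` topspace (product_topology (\<lambda>_. top_of_set {0..1}) (unit_functions X))
        \<subseteq> extensional (unit_functions Y)"
      unfolding h0_def by (intro image_subsetI restrict_extensional)
  qed
  have "h0 ` topspace (stone_cech X)
      \<subseteq> stone_cech_cube Y closure_of (h0 ` (stone_cech_emb X ` topspace X))"
    unfolding topspace_stone_cech by (rule continuous_map_image_closure_subset[OF h0_cont])
  also have "\<dots> \<subseteq> stone_cech_cube Y closure_of (stone_cech_emb Y ` topspace Y)"
    using continuous_map_image_subset_topspace[OF f]
    by (intro closure_of_mono) (auto simp only: h0_emb image_subset_iff intro!: imageI)
  finally have into: "h0 ` topspace (stone_cech X) \<subseteq> topspace (stone_cech Y)"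
    unfolding topspace_stone_cech .
  have "continuous_map (stone_cech X) (stone_cech_cube Y) h0"
    unfolding stone_cech_def by (rule continuous_map_from_subtopology[OF h0_cont])
  then have "continuous_map (stone_cech X) (stone_cech Y) h0"
    using into unfolding topspace_stone_cech unfolding stone_cech_def[of Y]
    by (simp only: continuous_map_in_subtopology image_subset_iff_funcset topspace_stone_cech simp_thms)
  then have cont: "continuous_map (stone_cech X) (stone_cech Y)
      (restrict h0 (topspace (stone_cech X)))"
    by (rule continuous_map_eq) (simp only: restrict_apply')
  have "stone_cech_emb X x \<in> topspace (stone_cech X)" if "x \<in> topspace X" for x
    unfolding topspace_stone_cech using that by (intro subsetD[OF stone_cech_emb_in_closure] imageI)
  then have "\<forall>x\<in>topspace X. restrict h0 (topspace (stone_cech X)) (stone_cech_emb X x)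
      = stone_cech_emb Y (f x)"
    by (auto simp only: restrict_apply' h0_emb)
  then have "stone_cech_extends X Y f (restrict h0 (topspace (stone_cech X)))"
    unfolding stone_cech_extends_def
    using cont by (intro conjI restrict_extensional)
  then show "\<exists>h. stone_cech_extends X Y f h"
    by (rule exI[where P = "stone_cech_extends X Y f"])
next
  fix h h' assume "stone_cech_extends X Y f h" and "stone_cech_extends X Y f h'"
  note hs = this[unfolded stone_cech_extends_def]
  note ext = hs[THEN conjunct1] and cont = hs[THEN conjunct2, THEN conjunct1]
    and emb = hs[THEN conjunct2, THEN conjunct2]
  have eq: "h p = h' p" if "p \<in> topspace (stone_cech X)" for p
  proof (rule forall_in_closure_of_eq[where X = "stone_cech X" and Y = "stone_cech Y"
        and S = "stone_cech_emb X ` topspace X" and f = h and g = h' and x = p])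
    show "p \<in> stone_cech X closure_of (stone_cech_emb X ` topspace X)"
      using that unfolding stone_cech_dense .
    fix q assume "q \<in> stone_cech_emb X ` topspace X"
    then obtain x where "x \<in> topspace X" "q = stone_cech_emb X x"
      by (rule imageE)
    then show "h q = h' q"
      by (simp only: bspec[OF emb(1)] bspec[OF emb(2)])
  qed (fact Hausdorff_space_stone_cech cont)+
  show "h = h'"
    by (rule extensionalityI[OF ext eq])
qed

definition cont_functions :: "'k topology \<Rightarrow> ('k \<Rightarrow> real) set" where
  "cont_functions K = {\<phi> \<in> extensional (topspace K). continuous_map K euclideanreal \<phi>}"

definition idem_measures :: "'k topology \<Rightarrow> (('k \<Rightarrow> real) \<Rightarrow> real) set" where
  "idem_measures K = {\<mu> \<in> extensional (cont_functions K).
     (\<forall>c. \<mu> (\<lambda>x\<in>topspace K. c) = c) \<and>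
     (\<forall>c. \<forall>\<phi>\<in>cont_functions K. \<mu> (\<lambda>x\<in>topspace K. c + \<phi> x) = c + \<mu> \<phi>) \<and>
     (\<forall>\<phi>\<in>cont_functions K. \<forall>\<psi>\<in>cont_functions K.
        \<mu> (\<lambda>x\<in>topspace K. max (\<phi> x) (\<psi> x)) = max (\<mu> \<phi>) (\<mu> \<psi>))}"

definition idem_space :: "'k topology \<Rightarrow> (('k \<Rightarrow> real) \<Rightarrow> real) topology" where
  "idem_space K = subtopology (powertop_real (cont_functions K)) (idem_measures K)"

definition idem_map ::
  "'k topology \<Rightarrow> 'l topology \<Rightarrow> ('k \<Rightarrow> 'l) \<Rightarrow> (('k \<Rightarrow> real) \<Rightarrow> real) \<Rightarrow> (('l \<Rightarrow> real) \<Rightarrow> real)" where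
  "idem_map K L f \<mu> = (\<lambda>\<phi>\<in>cont_functions L. \<mu> (compose (topspace K) \<phi> f))"

text \<open>For closed \<open>F\<close>, the set \<open>I(F)\<close> enters as its image under the map induced by the inclusion.\<close>

definition idem_supp :: "'k topology \<Rightarrow> (('k \<Rightarrow> real) \<Rightarrow> real) \<Rightarrow> 'k set" where
  "idem_supp K \<mu> = \<Inter> {F. closedin K F \<and>
     \<mu> \<in> idem_map (subtopology K F) K (\<lambda>x. x) ` idem_measures (subtopology K F)}"

definition Ibeta :: "'a topology \<Rightarrow> (((('a \<Rightarrow> real) \<Rightarrow> real) \<Rightarrow> real) \<Rightarrow> real) topology" where
  "Ibeta X = subtopology (idem_space (stone_cech X))
     {\<mu>. idem_supp (stone_cech X) \<mu> \<subseteq> stone_cech_emb X ` topspace X}"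

definition Ibeta_map ::
  "'a topology \<Rightarrow> 'b topology \<Rightarrow> ('a \<Rightarrow> 'b) \<Rightarrow>
     (((('a \<Rightarrow> real) \<Rightarrow> real) \<Rightarrow> real) \<Rightarrow> real) \<Rightarrow> (((('b \<Rightarrow> real) \<Rightarrow> real) \<Rightarrow> real) \<Rightarrow> real)" where
  "Ibeta_map X Y f =
     restrict (idem_map (stone_cech X) (stone_cech Y) (stone_cech_map X Y f)) (topspace (Ibeta X))"

text \<open>The cardinal bound is given as a cardinal order in the sense of \<open>Card_order\<close>.\<close>

definition Itau ::
  "'t rel \<Rightarrow> 'a topology \<Rightarrow> (((('a \<Rightarrow> real) \<Rightarrow> real) \<Rightarrow> real) \<Rightarrow> real) topology" where
  "Itau \<tau> X = subtopology (Ibeta X) {\<mu>. |idem_supp (stone_cech X) \<mu>| <o \<tau>}"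

definition Itau_map ::
  "'t rel \<Rightarrow> 'a topology \<Rightarrow> 'b topology \<Rightarrow> ('a \<Rightarrow> 'b) \<Rightarrow>
     (((('a \<Rightarrow> real) \<Rightarrow> real) \<Rightarrow> real) \<Rightarrow> real) \<Rightarrow> (((('b \<Rightarrow> real) \<Rightarrow> real) \<Rightarrow> real) \<Rightarrow> real)" where
  "Itau_map \<tau> X Y f = restrict (Ibeta_map X Y f) (topspace (Itau \<tau> X))"

text \<open>The max-plus semiring is the part of \<^typ>\<open>ereal\<close> below \<open>\<infinity>\<close>, with \<open>max\<close> as addition, \<open>+\<close> as
  multiplication and unit \<open>0\<close>.\<close>

definition max_plus_reals :: "ereal set" where
  "max_plus_reals = {a. a \<noteq> \<infinity>}"

text \<open>For \<open>max a b = 0\<close> the maximum below is finite, so \<^const>\<open>real_of_ereal\<close> loses nothing.\<close>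

definition max_plus_comb ::
  "'k topology \<Rightarrow> ereal \<Rightarrow> (('k \<Rightarrow> real) \<Rightarrow> real) \<Rightarrow> ereal \<Rightarrow> (('k \<Rightarrow> real) \<Rightarrow> real) \<Rightarrow>
     (('k \<Rightarrow> real) \<Rightarrow> real)" where
  "max_plus_comb K a \<mu> b \<nu> =
     (\<lambda>\<phi>\<in>cont_functions K. real_of_ereal (max (a + ereal (\<mu> \<phi>)) (b + ereal (\<nu> \<phi>))))"

definition max_plus_convex :: "'k topology \<Rightarrow> (('k \<Rightarrow> real) \<Rightarrow> real) set \<Rightarrow> bool" where
  "max_plus_convex K A \<longleftrightarrow>
     (\<forall>\<mu>\<in>A. \<forall>\<nu>\<in>A. \<forall>a\<in>max_plus_reals. \<forall>b\<in>max_plus_reals.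
        max a b = 0 \<longrightarrow> max_plus_comb K a \<mu> b \<nu> \<in> A)"

end

theory Submission
  imports Defs
begin

text \<open>
  Everything rests on one fact about an idempotent probability measure \<open>\<mu>\<close> on a compact Hausdorff
  space \<open>K\<close>: the intersection \<open>supp \<mu>\<close> of all closed \<open>F\<close> with \<open>\<mu> \<in> I(F)\<close> is itself such a set. Once
  this is known, supports can be bounded from above simply by exhibiting a closed set that carries
  the measure:

  \<^item> if \<open>f : K \<rightarrow> L\<close> is continuous, then \<open>f(supp \<mu>)\<close> is closed and carries \<open>I(f)(\<mu>)\<close>, whence
    \<open>supp I(f)(\<mu>) \<subseteq> f(supp \<mu>)\<close>. An image has at most the cardinality of the set, and \<open>\<beta>f\<close> maps
    \<open>X\<close> into \<open>Y\<close>, so \<open>I\<^sub>\<tau>\<close> is preserved by induced maps.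
  \<^item> \<open>supp \<mu> \<union> supp \<nu>\<close> carries every max-plus combination of \<open>\<mu>\<close> and \<open>\<nu>\<close>. An infinite
    cardinal exceeding two cardinalities exceeds that of the union, so \<open>I\<^sub>\<tau>(X)\<close> is max-plus convex.

  To prove the basic fact, Tietze's theorem is used to restate \<open>\<mu> \<in> I(F)\<close> without reference to
  measures on \<open>F\<close>: it holds iff \<open>\<mu>(\<phi>)\<close> depends only on the restriction of \<open>\<phi>\<close> to \<open>F\<close>
  (\<open>idem_measure_on_closed_iff\<close>). In this form, two closed sets can be intersected by gluing two
  functions along them and extending (\<open>determined_on_Int\<close>). Arbitrary intersections follow by
  compactness, because functions that agree on the whole intersection differ by less than any
  given \<open>e > 0\<close> on some finite one, and \<open>\<mu>\<close> is monotone and commutes with adding constants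
  (\<open>determined_on_Inter\<close>).

  Identities and composites are preserved because extensions to the Stone-Cech compactification
  are unique; continuity of induced maps is coordinatewise, and the Tychonoff property is inherited
  from a power of the real line.
\<close>

section \<open>Functionals that depend only on the values on a closed set\<close>

text \<open>For an idempotent probability measure \<open>\<mu>\<close> on a compact Hausdorff space and closed \<open>F\<close> this is the
  relation \<open>\<mu> \<in> I(F)\<close>.\<close>

definition determined_on :: "'k topology \<Rightarrow> (('k \<Rightarrow> real) \<Rightarrow> real) \<Rightarrow> 'k set \<Rightarrow> bool" where
  "determined_on K \<mu> F \<longleftrightarrow>
     (\<forall>\<phi>\<in>cont_functions K. \<forall>\<psi>\<in>cont_functions K. (\<forall>x\<in>F. \<phi> x = \<psi> x) \<longrightarrow> \<mu> \<phi> = \<mu> \<psi>)"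

lemma determined_onD:
  assumes "determined_on K \<mu> F" "\<phi> \<in> cont_functions K" "\<psi> \<in> cont_functions K"
    "\<And>x. x \<in> F \<Longrightarrow> \<phi> x = \<psi> x"
  shows "\<mu> \<phi> = \<mu> \<psi>"
  using assms unfolding determined_on_def by blast

lemma determined_on_topspace: "determined_on K \<mu> (topspace K)"
  unfolding determined_on_def cont_functions_def by (auto intro: arg_cong[where f = \<mu>] extensionalityI)

lemma determined_on_mono: "determined_on K \<mu> F \<Longrightarrow> F \<subseteq> G \<Longrightarrow> determined_on K \<mu> G"
  unfolding determined_on_def by blast

lemma restrict_cont_functions:
  "continuous_map K euclideanreal \<phi> \<Longrightarrow> restrict \<phi> (topspace K) \<in> cont_functions K"
  unfolding cont_functions_def
  by (auto intro: continuous_map_eq)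

lemma cont_functions_continuous:
  "\<phi> \<in> cont_functions K \<Longrightarrow> continuous_map K euclideanreal \<phi>"
  unfolding cont_functions_def by simp

lemma cont_functions_extensional: "\<phi> \<in> cont_functions K \<Longrightarrow> \<phi> \<in> extensional (topspace K)"
  unfolding cont_functions_def by simp

lemma const_cont_functions: "(\<lambda>x\<in>topspace K. c) \<in> cont_functions K"
  by (intro restrict_cont_functions continuous_intros) simp

lemma add_cont_functions:
  "\<phi> \<in> cont_functions K \<Longrightarrow> (\<lambda>x\<in>topspace K. c + \<phi> x) \<in> cont_functions K"
  by (intro restrict_cont_functions continuous_intros cont_functions_continuous) auto

lemma max_cont_functions:
  "\<phi> \<in> cont_functions K \<Longrightarrow> \<psi> \<in> cont_functions K \<Longrightarrow>
     (\<lambda>x\<in>topspace K. max (\<phi> x) (\<psi> x)) \<in> cont_functions K"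
  by (intro restrict_cont_functions continuous_intros cont_functions_continuous)

lemma restrict_to_closed_cont_functions:
  assumes "F \<subseteq> topspace K" "\<phi> \<in> cont_functions K"
  shows "restrict \<phi> F \<in> cont_functions (subtopology K F)"
proof -
  have "topspace (subtopology K F) = F"
    using assms(1) by (simp add: Int_absorb1)
  then show ?thesis
    using restrict_cont_functions[OF continuous_map_from_subtopology[OF cont_functions_continuous[OF assms(2)], of F]]
    by simp
qed

lemma compose_cont_functions:
  assumes "continuous_map K L f" "\<phi> \<in> cont_functions L"
  shows "compose (topspace K) \<phi> f \<in> cont_functions K"
proof -
  have "restrict (\<phi> \<circ> f) (topspace K) \<in> cont_functions K"
    by (intro restrict_cont_functions continuous_map_compose[OF assms(1)] cont_functions_continuous assms(2))
  then show ?thesis by (simp add: compose_def o_def)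
qed

lemma idem_measures_extensional: "\<mu> \<in> idem_measures K \<Longrightarrow> \<mu> \<in> extensional (cont_functions K)"
  unfolding idem_measures_def by blast

lemma idem_measures_const: "\<mu> \<in> idem_measures K \<Longrightarrow> \<mu> (\<lambda>x\<in>topspace K. c) = c"
  unfolding idem_measures_def by blast

lemma idem_measures_add:
  "\<mu> \<in> idem_measures K \<Longrightarrow> \<phi> \<in> cont_functions K \<Longrightarrow> \<mu> (\<lambda>x\<in>topspace K. c + \<phi> x) = c + \<mu> \<phi>"
  unfolding idem_measures_def by blast

lemma idem_measures_max:
  "\<mu> \<in> idem_measures K \<Longrightarrow> \<phi> \<in> cont_functions K \<Longrightarrow> \<psi> \<in> cont_functions K \<Longrightarrow>
     \<mu> (\<lambda>x\<in>topspace K. max (\<phi> x) (\<psi> x)) = max (\<mu> \<phi>) (\<mu> \<psi>)"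
  unfolding idem_measures_def by blast

lemma idem_measuresI:
  assumes "\<mu> \<in> extensional (cont_functions K)"
    and "\<And>c. \<mu> (\<lambda>x\<in>topspace K. c) = c"
    and "\<And>c \<phi>. \<phi> \<in> cont_functions K \<Longrightarrow> \<mu> (\<lambda>x\<in>topspace K. c + \<phi> x) = c + \<mu> \<phi>"
    and "\<And>\<phi> \<psi>. \<phi> \<in> cont_functions K \<Longrightarrow> \<psi> \<in> cont_functions K \<Longrightarrow>
      \<mu> (\<lambda>x\<in>topspace K. max (\<phi> x) (\<psi> x)) = max (\<mu> \<phi>) (\<mu> \<psi>)"
  shows "\<mu> \<in> idem_measures K"
  using assms unfolding idem_measures_def by blast

text \<open>Tietze's theorem: compact Hausdorff spaces are normal.\<close>

lemma closed_extension:
  assumes K: "compact_space K" "Hausdorff_space K" and F: "closedin K F"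
    and f: "continuous_map (subtopology K F) euclideanreal f"
  obtains \<phi> where "\<phi> \<in> cont_functions K" "\<And>x. x \<in> F \<Longrightarrow> \<phi> x = f x"
proof -
  have "normal_space K"
    using K compact_Hausdorff_or_regular_imp_normal_space by blast
  then obtain g where g: "continuous_map K euclideanreal g" "\<And>x. x \<in> F \<Longrightarrow> g x = f x"
    using Tietze_extension_realinterval[OF _ F is_interval_univ UNIV_not_empty f] by auto
  show thesis
  proof
    show "restrict g (topspace K) \<in> cont_functions K"
      by (rule restrict_cont_functions[OF g(1)])
    show "restrict g (topspace K) x = f x" if "x \<in> F" for x
      using that g(2) closedin_subset[OF F] by auto
  qed
qed

text \<open>A functional on \<open>C(K)\<close> that sees only values on \<open>F\<close> descends to \<open>C(F)\<close>, because by Tietze's theorem every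
  function in \<open>C(F)\<close> is a restriction. The descended functional inherits the three axioms since
  restriction commutes with the operations. This description makes the sets in the definition of
  the support easy to intersect.\<close>

lemma idem_measure_on_closed_iff:
  assumes K: "compact_space K" "Hausdorff_space K" and F: "closedin K F"
    and \<mu>: "\<mu> \<in> idem_measures K"
  shows "\<mu> \<in> idem_map (subtopology K F) K (\<lambda>x. x) ` idem_measures (subtopology K F)
     \<longleftrightarrow> determined_on K \<mu> F"
proof -
  have FK: "topspace (subtopology K F) = F"
    using closedin_subset[OF F] by (simp add: Int_absorb1)
  show ?thesis
  proof
    assume "\<mu> \<in> idem_map (subtopology K F) K (\<lambda>x. x) ` idem_measures (subtopology K F)"
    then obtain \<nu> where \<nu>: "\<mu> = (\<lambda>\<phi>\<in>cont_functions K. \<nu> (restrict \<phi> F))"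
      unfolding idem_map_def FK by (auto simp: compose_def)
    show "determined_on K \<mu> F"
      unfolding determined_on_def
    proof (intro ballI impI)
      fix \<phi> \<psi> assume *: "\<phi> \<in> cont_functions K" "\<psi> \<in> cont_functions K" "\<forall>x\<in>F. \<phi> x = \<psi> x"
      then have "restrict \<phi> F = restrict \<psi> F" by auto
      then show "\<mu> \<phi> = \<mu> \<psi>" unfolding \<nu> using * by simp
    qed
  next
    assume det: "determined_on K \<mu> F"
    \<comment> \<open>The chosen extension of \<open>\<psi>\<close> does not matter, by \<open>det\<close>.\<close>
    define \<nu> where "\<nu> = (\<lambda>\<psi>\<in>cont_functions (subtopology K F).
      \<mu> (SOME \<phi>. \<phi> \<in> cont_functions K \<and> restrict \<phi> F = \<psi>))"
    have restr: "\<nu> (restrict \<phi> F) = \<mu> \<phi>" if \<phi>: "\<phi> \<in> cont_functions K" for \<phi>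
    proof -
      let ?\<xi> = "SOME \<xi>. \<xi> \<in> cont_functions K \<and> restrict \<xi> F = restrict \<phi> F"
      have \<xi>: "?\<xi> \<in> cont_functions K \<and> restrict ?\<xi> F = restrict \<phi> F"
        by (rule someI[where x = \<phi>]) (simp add: \<phi>)
      have "?\<xi> x = \<phi> x" if "x \<in> F" for x
        using fun_cong[OF conjunct2[OF \<xi>], of x] that by simp
      then have "\<mu> ?\<xi> = \<mu> \<phi>"
        using determined_onD[OF det conjunct1[OF \<xi>] \<phi>] by blast
      then show ?thesis
        using restrict_to_closed_cont_functions[OF closedin_subset[OF F] \<phi>] by (simp add: \<nu>_def)
    qed
    have lift: "\<exists>\<phi>. \<phi> \<in> cont_functions K \<and> \<psi> = restrict \<phi> F"
      if \<psi>: "\<psi> \<in> cont_functions (subtopology K F)" for \<psi>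
    proof -
      obtain \<phi> where \<phi>: "\<phi> \<in> cont_functions K" "\<And>x. x \<in> F \<Longrightarrow> \<phi> x = \<psi> x"
        using closed_extension[OF K F cont_functions_continuous[OF \<psi>]] by blast
      have "\<psi> = restrict \<phi> F"
        using cont_functions_extensional[OF \<psi>] \<phi>(2) unfolding FK by (auto simp: extensional_def restrict_def)
      with \<phi> show ?thesis by blast
    qed
    have "\<nu> \<in> idem_measures (subtopology K F)"
    proof (rule idem_measuresI)
      show "\<nu> \<in> extensional (cont_functions (subtopology K F))"
        by (simp add: \<nu>_def)
      show "\<nu> (\<lambda>x\<in>topspace (subtopology K F). c) = c" for c
      proof -
        have eq: "(\<lambda>x\<in>F. c) = restrict (\<lambda>x\<in>topspace K. c) F"
          using closedin_subset[OF F] by (simp add: Int_absorb1)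
        show ?thesis
          unfolding FK eq restr[OF const_cont_functions] by (rule idem_measures_const[OF \<mu>])
      qed
      show "\<nu> (\<lambda>x\<in>topspace (subtopology K F). c + \<psi> x) = c + \<nu> \<psi>"
        if \<psi>: "\<psi> \<in> cont_functions (subtopology K F)" for c \<psi>
      proof -
        obtain \<phi> where \<phi>: "\<phi> \<in> cont_functions K" "\<psi> = restrict \<phi> F"
          using lift[OF \<psi>] by blast
        have eq: "(\<lambda>x\<in>F. c + \<psi> x) = restrict (\<lambda>x\<in>topspace K. c + \<phi> x) F"
          using closedin_subset[OF F] by (auto simp: \<phi> restrict_def fun_eq_iff)
        show ?thesis
          unfolding FK eq unfolding \<phi>(2) restr[OF add_cont_functions[OF \<phi>(1)]] restr[OF \<phi>(1)]
          by (rule idem_measures_add[OF \<mu> \<phi>(1)])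
      qed
      show "\<nu> (\<lambda>x\<in>topspace (subtopology K F). max (\<psi>\<^sub>1 x) (\<psi>\<^sub>2 x)) = max (\<nu> \<psi>\<^sub>1) (\<nu> \<psi>\<^sub>2)"
        if \<psi>: "\<psi>\<^sub>1 \<in> cont_functions (subtopology K F)" "\<psi>\<^sub>2 \<in> cont_functions (subtopology K F)" for \<psi>\<^sub>1 \<psi>\<^sub>2
      proof -
        obtain \<phi>\<^sub>1 \<phi>\<^sub>2 where \<phi>: "\<phi>\<^sub>1 \<in> cont_functions K" "\<psi>\<^sub>1 = restrict \<phi>\<^sub>1 F"
          "\<phi>\<^sub>2 \<in> cont_functions K" "\<psi>\<^sub>2 = restrict \<phi>\<^sub>2 F"
          using lift[OF \<psi>(1)] lift[OF \<psi>(2)] by blast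
        have eq: "(\<lambda>x\<in>F. max (\<psi>\<^sub>1 x) (\<psi>\<^sub>2 x)) = restrict (\<lambda>x\<in>topspace K. max (\<phi>\<^sub>1 x) (\<phi>\<^sub>2 x)) F"
          using closedin_subset[OF F] by (auto simp: \<phi> restrict_def fun_eq_iff)
        show ?thesis
          unfolding FK eq
          unfolding \<phi>(2,4) restr[OF max_cont_functions[OF \<phi>(1,3)]] restr[OF \<phi>(1)] restr[OF \<phi>(3)]
          by (rule idem_measures_max[OF \<mu> \<phi>(1,3)])
      qed
    qed
    moreover have "\<mu> = idem_map (subtopology K F) K (\<lambda>x. x) \<nu>"
    proof (rule extensionalityI[OF idem_measures_extensional[OF \<mu>]])
      show "idem_map (subtopology K F) K (\<lambda>x. x) \<nu> \<in> extensional (cont_functions K)"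
        by (simp add: idem_map_def)
      show "\<mu> \<phi> = idem_map (subtopology K F) K (\<lambda>x. x) \<nu> \<phi>" if "\<phi> \<in> cont_functions K" for \<phi>
        using that restr[OF that] by (simp only: idem_map_def FK compose_def restrict_apply')
    qed
    ultimately show "\<mu> \<in> idem_map (subtopology K F) K (\<lambda>x. x) ` idem_measures (subtopology K F)"
      by blast
  qed
qed

text \<open>If \<open>\<phi>\<close> and \<open>\<psi>\<close> agree on \<open>F \<inter> G\<close>, then \<open>\<phi>\<close> on \<open>F\<close> and \<open>\<psi>\<close> on \<open>G\<close> glue to a continuous function on
  \<open>F \<union> G\<close>. An extension \<open>\<xi>\<close> of it to \<open>K\<close> links the two values: \<open>\<mu>(\<phi>) = \<mu>(\<xi>) = \<mu>(\<psi>)\<close>.\<close>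

lemma determined_on_Int:
  assumes K: "compact_space K" "Hausdorff_space K" and FG: "closedin K F" "closedin K G"
    and det: "determined_on K \<mu> F" "determined_on K \<mu> G"
  shows "determined_on K \<mu> (F \<inter> G)"
  unfolding determined_on_def
proof (intro ballI impI)
  fix \<phi> \<psi> assume \<phi>: "\<phi> \<in> cont_functions K" and \<psi>: "\<psi> \<in> cont_functions K"
    and eq: "\<forall>x\<in>F \<inter> G. \<phi> x = \<psi> x"
  have "continuous_map (subtopology K (F \<union> G)) euclideanreal (\<lambda>x. if x \<in> F then \<phi> x else \<psi> x)"
  proof (rule pasting_lemma_closed[where I = "{True, False}" and T = "\<lambda>b. if b then F else G"
        and f = "\<lambda>b. if b then \<phi> else \<psi>"])
    show "closedin (subtopology K (F \<union> G)) (if b then F else G)" for b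
      using FG by (auto intro: closedin_subset_topspace)
    show "continuous_map (subtopology (subtopology K (F \<union> G)) (if b then F else G)) euclideanreal
        (if b then \<phi> else \<psi>)" for b
      using cont_functions_continuous[OF \<phi>] cont_functions_continuous[OF \<psi>]
      by (auto intro!: continuous_map_from_subtopology)
  qed (use eq in \<open>auto split: if_splits\<close>)
  then obtain \<xi> where \<xi>: "\<xi> \<in> cont_functions K"
    "\<And>x. x \<in> F \<union> G \<Longrightarrow> \<xi> x = (if x \<in> F then \<phi> x else \<psi> x)"
    using closed_extension[OF K closedin_Un[OF FG]] by blast
  have "\<mu> \<phi> = \<mu> \<xi>"
    by (rule determined_onD[OF det(1) \<phi> \<xi>(1)]) (simp add: \<xi>(2))
  also have "\<mu> \<xi> = \<mu> \<psi>"
    by (rule determined_onD[OF det(2) \<xi>(1) \<psi>]) (use eq in \<open>simp add: \<xi>(2)\<close>)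
  finally show "\<mu> \<phi> = \<mu> \<psi>" .
qed

text \<open>The factor \<open>topspace K\<close> covers the empty family, whose intersection is the whole type.\<close>

lemma determined_on_finite_Inter:
  assumes K: "compact_space K" "Hausdorff_space K" and "finite \<F>"
    and "\<And>F. F \<in> \<F> \<Longrightarrow> closedin K F \<and> determined_on K \<mu> F"
  shows "closedin K (topspace K \<inter> \<Inter>\<F>) \<and> determined_on K \<mu> (topspace K \<inter> \<Inter>\<F>)"
  using assms(3,4)
proof (induction \<F> rule: finite_induct)
  case empty
  then show ?case by (simp add: determined_on_topspace)
next
  case (insert F \<F>)
  have "topspace K \<inter> \<Inter>(insert F \<F>) = F \<inter> (topspace K \<inter> \<Inter>\<F>)" by blast
  then show ?case
    using insert determined_on_Int[OF K, of F "topspace K \<inter> \<Inter>\<F>" \<mu>] by (metis closedin_Int insertCI)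
qed

text \<open>Monotonicity, read off from the axiom for maxima: on \<open>F\<close> the function \<open>c + \<psi>\<close> is its own maximum with
  \<open>\<phi>\<close>. The constant is kept so that functions can be compared up to an error.\<close>

lemma idem_measure_le_on_determining_set:
  assumes \<mu>: "\<mu> \<in> idem_measures K" and det: "determined_on K \<mu> F" and F: "F \<subseteq> topspace K"
    and \<phi>: "\<phi> \<in> cont_functions K" and \<psi>: "\<psi> \<in> cont_functions K"
    and le: "\<And>x. x \<in> F \<Longrightarrow> \<phi> x \<le> c + \<psi> x"
  shows "\<mu> \<phi> \<le> c + \<mu> \<psi>"
proof -
  let ?\<psi>' = "\<lambda>x\<in>topspace K. c + \<psi> x"
  have "max (\<mu> \<phi>) (\<mu> ?\<psi>') = \<mu> (\<lambda>x\<in>topspace K. max (\<phi> x) (?\<psi>' x))"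
    by (rule idem_measures_max[OF \<mu> \<phi> add_cont_functions[OF \<psi>], symmetric])
  also have "\<dots> = \<mu> ?\<psi>'"
    by (rule determined_onD[OF det max_cont_functions[OF \<phi> add_cont_functions[OF \<psi>]]
          add_cont_functions[OF \<psi>]])
      (use le F in \<open>auto simp: max_def\<close>)
  finally show ?thesis
    using idem_measures_add[OF \<mu> \<psi>, of c] by simp
qed

text \<open>The step from finite to arbitrary intersections. Exact agreement on the infinite intersection need not
  extend to any finite one, so compactness gives only agreement up to \<open>e\<close> there; this suffices
  because \<open>\<mu>\<close> turns it into an estimate up to \<open>e\<close> of its values.\<close>

lemma determined_on_Inter:
  assumes K: "compact_space K" "Hausdorff_space K" and \<mu>: "\<mu> \<in> idem_measures K"
    and \<F>: "\<And>F. F \<in> \<F> \<Longrightarrow> closedin K F \<and> determined_on K \<mu> F"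
  shows "determined_on K \<mu> (topspace K \<inter> \<Inter>\<F>)"
proof -
  have le: "\<mu> \<phi> \<le> e + \<mu> \<psi>"
    if \<phi>: "\<phi> \<in> cont_functions K" and \<psi>: "\<psi> \<in> cont_functions K"
      and eq: "\<forall>x\<in>topspace K \<inter> \<Inter>\<F>. \<phi> x = \<psi> x" and e: "e > 0" for \<phi> \<psi> and e :: real
  proof -
    \<comment> \<open>The closed set where the estimate with error \<open>e\<close> may fail; it misses the intersection.\<close>
    define B where "B = {x \<in> topspace K. \<phi> x - \<psi> x \<in> {e..}}"
    have B: "closedin K B"
      unfolding B_def
      by (intro closedin_continuous_map_preimage[where Y = euclideanreal] continuous_intros
          cont_functions_continuous \<phi> \<psi>) simp
    have empty: "\<Inter>(insert B \<F>) = {}"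
    proof (rule equals0I)
      fix x assume "x \<in> \<Inter>(insert B \<F>)"
      then have "x \<in> topspace K \<inter> \<Inter>\<F>" and "e \<le> \<phi> x - \<psi> x"
        by (auto simp: B_def)
      with eq e show False by auto
    qed
    have "\<forall>C\<in>insert B \<F>. closedin K C"
      using B \<F> by blast
    with K(1)[unfolded compact_space_fip, THEN spec, of "insert B \<F>"] empty
    have "\<not> (\<forall>\<G>. finite \<G> \<and> \<G> \<subseteq> insert B \<F> \<longrightarrow> \<Inter>\<G> \<noteq> {})"
      by argo
    then obtain \<G> where \<G>: "finite \<G>" "\<G> \<subseteq> insert B \<F>" "\<Inter>\<G> = {}"
      by blast
    have fin: "closedin K (topspace K \<inter> \<Inter>(\<G> - {B})) \<and> determined_on K \<mu> (topspace K \<inter> \<Inter>(\<G> - {B}))"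
    proof (rule determined_on_finite_Inter[OF K])
      show "finite (\<G> - {B})" using \<G>(1) by simp
      show "closedin K F \<and> determined_on K \<mu> F" if "F \<in> \<G> - {B}" for F
        using \<G>(2) \<F> that by blast
    qed
    show "\<mu> \<phi> \<le> e + \<mu> \<psi>"
    proof (rule idem_measure_le_on_determining_set[OF \<mu> conjunct2[OF fin] _ \<phi> \<psi>])
      fix x assume x: "x \<in> topspace K \<inter> \<Inter>(\<G> - {B})"
      then have "x \<notin> B" using \<G>(3) by blast
      with x show "\<phi> x \<le> e + \<psi> x" unfolding B_def by auto
    qed blast
  qed
  show ?thesis
    unfolding determined_on_def
  proof (intro ballI impI antisym)
    fix \<phi> \<psi> assume *: "\<phi> \<in> cont_functions K" "\<psi> \<in> cont_functions K"
      "\<forall>x\<in>topspace K \<inter> \<Inter>\<F>. \<phi> x = \<psi> x"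
    show "\<mu> \<phi> \<le> \<mu> \<psi>"
      by (rule field_le_epsilon) (use le[OF *] in \<open>simp add: add.commute\<close>)
    show "\<mu> \<psi> \<le> \<mu> \<phi>"
      by (rule field_le_epsilon) (use le[OF *(2,1)] *(3) in \<open>simp add: add.commute\<close>)
  qed
qed

lemma idem_supp_eq:
  assumes "compact_space K" "Hausdorff_space K" "\<mu> \<in> idem_measures K"
  shows "idem_supp K \<mu> = topspace K \<inter> \<Inter>{F. closedin K F \<and> determined_on K \<mu> F}"
proof -
  have "{F. closedin K F \<and> \<mu> \<in> idem_map (subtopology K F) K (\<lambda>x. x) ` idem_measures (subtopology K F)}
      = {F. closedin K F \<and> determined_on K \<mu> F}"
    using idem_measure_on_closed_iff[OF assms(1,2) _ assms(3)] by blast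
  then show ?thesis
    unfolding idem_supp_def using determined_on_topspace[of K \<mu>] by auto
qed

text \<open>In the usual terms: \<open>\<mu> \<in> I(supp \<mu>)\<close>.\<close>

lemma determined_on_idem_supp:
  assumes "compact_space K" "Hausdorff_space K" "\<mu> \<in> idem_measures K"
  shows "determined_on K \<mu> (idem_supp K \<mu>)"
  unfolding idem_supp_eq[OF assms] by (rule determined_on_Inter[OF assms]) blast

lemma closedin_idem_supp:
  assumes "compact_space K" "Hausdorff_space K" "\<mu> \<in> idem_measures K"
  shows "closedin K (idem_supp K \<mu>)"
proof -
  have "idem_supp K \<mu> = \<Inter>(insert (topspace K) {F. closedin K F \<and> determined_on K \<mu> F})"
    unfolding idem_supp_eq[OF assms] by simp
  also have "closedin K \<dots>"
    by (rule closedin_Inter) auto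
  finally show ?thesis .
qed

lemma idem_supp_subset:
  assumes "compact_space K" "Hausdorff_space K" "\<mu> \<in> idem_measures K"
    and "closedin K F" "determined_on K \<mu> F"
  shows "idem_supp K \<mu> \<subseteq> F"
  unfolding idem_supp_eq[OF assms(1-3)]
  by (rule le_infI2, rule Inf_lower) (simp add: assms(4,5))

section \<open>The maps induced by continuous maps\<close>

lemma idem_map_in_idem_measures:
  assumes f: "continuous_map K L f" and \<mu>: "\<mu> \<in> idem_measures K"
  shows "idem_map K L f \<mu> \<in> idem_measures L"
proof (rule idem_measuresI)
  have fK: "f x \<in> topspace L" if "x \<in> topspace K" for x
    using continuous_map_image_subset_topspace[OF f] that by blast
  note pull = compose_cont_functions[OF f]
  show "idem_map K L f \<mu> \<in> extensional (cont_functions L)"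
    by (simp add: idem_map_def)
  show "idem_map K L f \<mu> (\<lambda>x\<in>topspace L. c) = c" for c
  proof -
    have "compose (topspace K) (\<lambda>x\<in>topspace L. c) f = (\<lambda>x\<in>topspace K. c)"
      using fK by (auto simp: compose_def)
    then show ?thesis
      by (simp add: idem_map_def const_cont_functions idem_measures_const[OF \<mu>])
  qed
  show "idem_map K L f \<mu> (\<lambda>x\<in>topspace L. c + \<phi> x) = c + idem_map K L f \<mu> \<phi>"
    if \<phi>: "\<phi> \<in> cont_functions L" for c \<phi>
  proof -
    have "compose (topspace K) (\<lambda>x\<in>topspace L. c + \<phi> x) f
        = (\<lambda>x\<in>topspace K. c + compose (topspace K) \<phi> f x)"
      using fK by (auto simp: compose_def)
    then show ?thesis
      by (simp add: idem_map_def \<phi> add_cont_functions idem_measures_add[OF \<mu> pull])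
  qed
  show "idem_map K L f \<mu> (\<lambda>x\<in>topspace L. max (\<phi> x) (\<psi> x))
      = max (idem_map K L f \<mu> \<phi>) (idem_map K L f \<mu> \<psi>)"
    if \<phi>: "\<phi> \<in> cont_functions L" and \<psi>: "\<psi> \<in> cont_functions L" for \<phi> \<psi>
  proof -
    have "compose (topspace K) (\<lambda>x\<in>topspace L. max (\<phi> x) (\<psi> x)) f
        = (\<lambda>x\<in>topspace K. max (compose (topspace K) \<phi> f x) (compose (topspace K) \<psi> f x))"
      using fK by (auto simp: compose_def)
    then show ?thesis
      by (simp add: idem_map_def \<phi> \<psi> max_cont_functions idem_measures_max[OF \<mu> pull pull])
  qed
qed

text \<open>Compactness is used twice: the support of \<open>\<mu>\<close> determines \<open>\<mu>\<close>, and its image under \<open>f\<close> is closed.\<close>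

lemma idem_supp_idem_map:
  assumes K: "compact_space K" "Hausdorff_space K" and L: "compact_space L" "Hausdorff_space L"
    and f: "continuous_map K L f" and \<mu>: "\<mu> \<in> idem_measures K"
  shows "idem_supp L (idem_map K L f \<mu>) \<subseteq> f ` idem_supp K \<mu>"
proof (rule idem_supp_subset[OF L idem_map_in_idem_measures[OF f \<mu>]])
  have S: "idem_supp K \<mu> \<subseteq> topspace K"
    by (rule closedin_subset[OF closedin_idem_supp[OF K \<mu>]])
  have "compactin K (idem_supp K \<mu>)"
    by (rule closedin_compact_space[OF K(1) closedin_idem_supp[OF K \<mu>]])
  then show "closedin L (f ` idem_supp K \<mu>)"
    by (intro compactin_imp_closedin[OF L(2)] image_compactin[OF _ f])
  show "determined_on L (idem_map K L f \<mu>) (f ` idem_supp K \<mu>)"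
    unfolding determined_on_def
  proof (intro ballI impI)
    fix \<phi> \<psi> assume \<phi>: "\<phi> \<in> cont_functions L" and \<psi>: "\<psi> \<in> cont_functions L"
      and eq: "\<forall>y\<in>f ` idem_supp K \<mu>. \<phi> y = \<psi> y"
    have "\<mu> (compose (topspace K) \<phi> f) = \<mu> (compose (topspace K) \<psi> f)"
      by (rule determined_onD[OF determined_on_idem_supp[OF K \<mu>]
            compose_cont_functions[OF f \<phi>] compose_cont_functions[OF f \<psi>]])
        (use eq S in \<open>auto simp: compose_def\<close>)
    then show "idem_map K L f \<mu> \<phi> = idem_map K L f \<mu> \<psi>"
      by (simp add: idem_map_def \<phi> \<psi>)
  qed
qed

lemma topspace_idem_space: "topspace (idem_space K) = idem_measures K"
proof -
  have "idem_measures K \<subseteq> extensional (cont_functions K)"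
    by (auto simp: idem_measures_extensional)
  then show ?thesis
    unfolding idem_space_def by (auto simp: PiE_def)
qed

lemma continuous_map_idem_map:
  assumes f: "continuous_map K L f"
  shows "continuous_map (idem_space K) (idem_space L) (idem_map K L f)"
  unfolding idem_space_def[of L] continuous_map_in_subtopology
proof
  show "continuous_map (idem_space K) (powertop_real (cont_functions L)) (idem_map K L f)"
    unfolding continuous_map_componentwise
  proof (intro conjI ballI)
    show "idem_map K L f ` topspace (idem_space K) \<subseteq> extensional (cont_functions L)"
      by (auto simp: idem_map_def)
    fix \<phi> assume \<phi>: "\<phi> \<in> cont_functions L"
    have "continuous_map (idem_space K) euclideanreal (\<lambda>\<mu>. \<mu> (compose (topspace K) \<phi> f))"
      unfolding idem_space_def
      by (intro continuous_map_from_subtopology continuous_map_product_projection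
          compose_cont_functions[OF f \<phi>])
    then show "continuous_map (idem_space K) euclideanreal (\<lambda>\<mu>. idem_map K L f \<mu> \<phi>)"
      by (simp add: idem_map_def \<phi>)
  qed
  show "idem_map K L f \<in> topspace (idem_space K) \<rightarrow> idem_measures L"
    using idem_map_in_idem_measures[OF f] by (auto simp: topspace_idem_space)
qed

lemma idem_map_id:
  assumes "\<mu> \<in> idem_measures K" and "\<And>x. x \<in> topspace K \<Longrightarrow> f x = x"
  shows "idem_map K K f \<mu> = \<mu>"
proof (rule extensionalityI[OF _ idem_measures_extensional[OF assms(1)]])
  show "idem_map K K f \<mu> \<in> extensional (cont_functions K)"
    by (simp add: idem_map_def)
  fix \<phi> assume \<phi>: "\<phi> \<in> cont_functions K"
  have "compose (topspace K) \<phi> f = \<phi>"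
    using cont_functions_extensional[OF \<phi>] assms(2) by (auto simp: compose_def extensional_def)
  then show "idem_map K K f \<mu> \<phi> = \<mu> \<phi>"
    by (simp add: idem_map_def \<phi>)
qed

lemma idem_map_compose:
  fixes M :: "'m topology"
  assumes f: "continuous_map K L f" and g: "continuous_map L M g"
  shows "idem_map K M (compose (topspace K) g f) \<mu> = idem_map L M g (idem_map K L f \<mu>)"
proof
  fix \<phi> :: "'m \<Rightarrow> real"
  have fK: "f x \<in> topspace L" if "x \<in> topspace K" for x
    using continuous_map_image_subset_topspace[OF f] that by blast
  have "compose (topspace K) \<phi> (compose (topspace K) g f)
      = compose (topspace K) (compose (topspace L) \<phi> g) f"
    using fK by (auto simp: compose_def)
  then show "idem_map K M (compose (topspace K) g f) \<mu> \<phi> = idem_map L M g (idem_map K L f \<mu>) \<phi>"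
    using compose_cont_functions[OF g] by (auto simp: idem_map_def)
qed

section \<open>Max-plus combinations\<close>

text \<open>Since one of the two coefficients is \<open>0\<close> and the other is at most \<open>0\<close>, the maximum is a
  finite extended real, so nothing is lost by passing to a real number and the semiring identities can be checked in \<^typ>\<open>ereal\<close>.\<close>

lemma max_plus_comb_apply:
  assumes "\<phi> \<in> cont_functions K" and "max a b = 0"
  shows "ereal (max_plus_comb K a \<mu> b \<nu> \<phi>) = max (a + ereal (\<mu> \<phi>)) (b + ereal (\<nu> \<phi>))"
  using assms
  by (cases a; cases b) (auto simp: max_plus_comb_def max_def zero_ereal_def split: if_splits)

lemma max_plus_comb_in_idem_measures:
  assumes \<mu>: "\<mu> \<in> idem_measures K" and \<nu>: "\<nu> \<in> idem_measures K" and ab: "max a b = 0"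
  shows "max_plus_comb K a \<mu> b \<nu> \<in> idem_measures K"
proof (rule idem_measuresI)
  note comb = max_plus_comb_apply[OF _ ab]
  show "max_plus_comb K a \<mu> b \<nu> \<in> extensional (cont_functions K)"
    by (simp add: max_plus_comb_def)
  show "max_plus_comb K a \<mu> b \<nu> (\<lambda>x\<in>topspace K. c) = c" for c
    using comb[OF const_cont_functions[of c K], of \<mu> \<nu>] ab
    unfolding idem_measures_const[OF \<mu>] idem_measures_const[OF \<nu>]
    by (cases a; cases b) (auto simp: max_def zero_ereal_def split: if_splits)
  show "max_plus_comb K a \<mu> b \<nu> (\<lambda>x\<in>topspace K. c + \<phi> x) = c + max_plus_comb K a \<mu> b \<nu> \<phi>"
    if \<phi>: "\<phi> \<in> cont_functions K" for c \<phi>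
    using comb[OF \<phi>, of \<mu> \<nu>] comb[OF add_cont_functions[OF \<phi>], of \<mu> \<nu> c] ab
    unfolding idem_measures_add[OF \<mu> \<phi>] idem_measures_add[OF \<nu> \<phi>]
    by (cases a; cases b) (auto simp: max_def zero_ereal_def split: if_splits)
  show "max_plus_comb K a \<mu> b \<nu> (\<lambda>x\<in>topspace K. max (\<phi> x) (\<psi> x))
      = max (max_plus_comb K a \<mu> b \<nu> \<phi>) (max_plus_comb K a \<mu> b \<nu> \<psi>)"
    if \<phi>: "\<phi> \<in> cont_functions K" and \<psi>: "\<psi> \<in> cont_functions K" for \<phi> \<psi>
    using comb[OF \<phi>, of \<mu> \<nu>] comb[OF \<psi>, of \<mu> \<nu>]
      comb[OF max_cont_functions[OF \<phi> \<psi>], of \<mu> \<nu>] ab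
    unfolding idem_measures_max[OF \<mu> \<phi> \<psi>] idem_measures_max[OF \<nu> \<phi> \<psi>]
    by (cases a; cases b) (auto simp: max_def zero_ereal_def split: if_splits)
qed

text \<open>If \<open>\<phi>\<close> and \<open>\<psi>\<close> agree on both supports, then both terms of the maximum agree. The inclusion can be
  strict: with \<open>a = -\<infinity>\<close> the combination is \<open>\<nu>\<close>.\<close>

lemma idem_supp_max_plus_comb:
  assumes K: "compact_space K" "Hausdorff_space K"
    and \<mu>: "\<mu> \<in> idem_measures K" and \<nu>: "\<nu> \<in> idem_measures K" and ab: "max a b = 0"
  shows "idem_supp K (max_plus_comb K a \<mu> b \<nu>) \<subseteq> idem_supp K \<mu> \<union> idem_supp K \<nu>"
proof (rule idem_supp_subset[OF K max_plus_comb_in_idem_measures[OF \<mu> \<nu> ab]])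
  show "closedin K (idem_supp K \<mu> \<union> idem_supp K \<nu>)"
    by (intro closedin_Un closedin_idem_supp K \<mu> \<nu>)
  have det: "determined_on K \<mu> (idem_supp K \<mu> \<union> idem_supp K \<nu>)"
      "determined_on K \<nu> (idem_supp K \<mu> \<union> idem_supp K \<nu>)"
    by (rule determined_on_mono[OF determined_on_idem_supp[OF K \<mu>] Un_upper1],
        rule determined_on_mono[OF determined_on_idem_supp[OF K \<nu>] Un_upper2])
  show "determined_on K (max_plus_comb K a \<mu> b \<nu>) (idem_supp K \<mu> \<union> idem_supp K \<nu>)"
    unfolding determined_on_def
  proof (intro ballI impI)
    fix \<phi> \<psi> assume \<phi>: "\<phi> \<in> cont_functions K" and \<psi>: "\<psi> \<in> cont_functions K"
      and eq: "\<forall>x\<in>idem_supp K \<mu> \<union> idem_supp K \<nu>. \<phi> x = \<psi> x"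
    have "\<mu> \<phi> = \<mu> \<psi>"
      by (rule determined_onD[OF det(1) \<phi> \<psi> bspec[OF eq]])
    moreover have "\<nu> \<phi> = \<nu> \<psi>"
      by (rule determined_onD[OF det(2) \<phi> \<psi> bspec[OF eq]])
    ultimately show "max_plus_comb K a \<mu> b \<nu> \<phi> = max_plus_comb K a \<mu> b \<nu> \<psi>"
      by (simp add: max_plus_comb_def \<phi> \<psi>)
  qed
qed

section \<open>The extension of a map to the compactifications\<close>

lemma stone_cech_map_extends:
  "continuous_map X Y f \<Longrightarrow> stone_cech_extends X Y f (stone_cech_map X Y f)"
  unfolding stone_cech_map_def by (rule theI'[OF stone_cech_extension_unique])

lemma stone_cech_map_eqI:
  "continuous_map X Y f \<Longrightarrow> stone_cech_extends X Y f h \<Longrightarrow> stone_cech_map X Y f = h"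
  unfolding stone_cech_map_def by (rule the1_equality[OF stone_cech_extension_unique])

lemma continuous_stone_cech_map:
  "continuous_map X Y f \<Longrightarrow> continuous_map (stone_cech X) (stone_cech Y) (stone_cech_map X Y f)"
  using stone_cech_map_extends unfolding stone_cech_extends_def by blast

lemma stone_cech_map_emb:
  "continuous_map X Y f \<Longrightarrow> x \<in> topspace X \<Longrightarrow>
     stone_cech_map X Y f (stone_cech_emb X x) = stone_cech_emb Y (f x)"
  using stone_cech_map_extends unfolding stone_cech_extends_def by blast

lemma stone_cech_emb_in_topspace: "x \<in> topspace X \<Longrightarrow> stone_cech_emb X x \<in> topspace (stone_cech X)"
  using stone_cech_emb_in_closure[of X] unfolding topspace_stone_cech by blast

lemma stone_cech_map_id:
  "stone_cech_map X X (\<lambda>x. x) = (\<lambda>p\<in>topspace (stone_cech X). p)"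
proof (rule stone_cech_map_eqI)
  have "continuous_map (stone_cech X) (stone_cech X) (\<lambda>p\<in>topspace (stone_cech X). p)"
    by (rule continuous_map_eq[OF continuous_map_id]) simp
  then show "stone_cech_extends X X (\<lambda>x. x) (\<lambda>p\<in>topspace (stone_cech X). p)"
    unfolding stone_cech_extends_def by (simp add: stone_cech_emb_in_topspace)
qed simp

lemma stone_cech_map_compose:
  assumes f: "continuous_map X Y f" and g: "continuous_map Y Z g"
  shows "stone_cech_map X Z (g \<circ> f)
    = compose (topspace (stone_cech X)) (stone_cech_map Y Z g) (stone_cech_map X Y f)"
proof (rule stone_cech_map_eqI[OF continuous_map_compose[OF f g]])
  let ?h = "compose (topspace (stone_cech X)) (stone_cech_map Y Z g) (stone_cech_map X Y f)"
  have "continuous_map (stone_cech X) (stone_cech Z) ?h"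
    by (rule continuous_map_eq[OF continuous_map_compose[OF continuous_stone_cech_map[OF f]
            continuous_stone_cech_map[OF g]]]) (simp add: compose_def)
  moreover have "f x \<in> topspace Y" if "x \<in> topspace X" for x
    using continuous_map_image_subset_topspace[OF f] that by blast
  ultimately show "stone_cech_extends X Z (g \<circ> f) ?h"
    unfolding stone_cech_extends_def
    by (simp add: compose_def stone_cech_emb_in_topspace stone_cech_map_emb[OF f] stone_cech_map_emb[OF g])
qed

section \<open>Measures whose support has small cardinality\<close>

lemma in_topspace_Itau_iff:
  "\<mu> \<in> topspace (Itau \<tau> X) \<longleftrightarrow> \<mu> \<in> idem_measures (stone_cech X) \<and>
     idem_supp (stone_cech X) \<mu> \<subseteq> stone_cech_emb X ` topspace X \<and>
     |idem_supp (stone_cech X) \<mu>| <o \<tau>"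
  unfolding Itau_def Ibeta_def by (simp add: topspace_idem_space)

lemma tychonoff_Itau: "tychonoff_space (Itau \<tau> X)"
  unfolding tychonoff_space_def Itau_def Ibeta_def idem_space_def
  by (simp add: completely_regular_space_subtopology completely_regular_space_product_topology
      Hausdorff_space_subtopology Hausdorff_space_product_topology
      metrizable_imp_completely_regular_space metrizable_space_euclidean)

lemma Itau_map_apply:
  "\<mu> \<in> topspace (Itau \<tau> X) \<Longrightarrow> Itau_map \<tau> X Y f \<mu> = Ibeta_map X Y f \<mu>"
  unfolding Itau_map_def by simp

lemma Ibeta_map_apply:
  "\<mu> \<in> topspace (Itau \<tau> X) \<Longrightarrow>
     Ibeta_map X Y f \<mu> = idem_map (stone_cech X) (stone_cech Y) (stone_cech_map X Y f) \<mu>"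
  unfolding Ibeta_map_def Itau_def by simp

lemma Ibeta_map_in_Itau:
  assumes f: "continuous_map X Y f" and \<mu>: "\<mu> \<in> topspace (Itau \<tau> X)"
  shows "Ibeta_map X Y f \<mu> \<in> topspace (Itau \<tau> Y)"
proof -
  let ?h = "stone_cech_map X Y f" and ?S = "idem_supp (stone_cech X) \<mu>"
  let ?\<nu> = "idem_map (stone_cech X) (stone_cech Y) ?h \<mu>"
  note [simp] = compact_space_stone_cech Hausdorff_space_stone_cech
  have h: "continuous_map (stone_cech X) (stone_cech Y) ?h"
    by (rule continuous_stone_cech_map[OF f])
  from \<mu> have \<mu>': "\<mu> \<in> idem_measures (stone_cech X)" "?S \<subseteq> stone_cech_emb X ` topspace X" "|?S| <o \<tau>"
    by (simp_all add: in_topspace_Itau_iff)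
  have supp: "idem_supp (stone_cech Y) ?\<nu> \<subseteq> ?h ` ?S"
    by (rule idem_supp_idem_map) (simp_all add: h \<mu>')
  have "?h ` ?S \<subseteq> ?h ` stone_cech_emb X ` topspace X"
    using \<mu>'(2) by (rule image_mono)
  also have "\<dots> \<subseteq> stone_cech_emb Y ` topspace Y"
    using continuous_map_image_subset_topspace[OF f] by (auto simp: stone_cech_map_emb[OF f])
  finally have "?h ` ?S \<subseteq> stone_cech_emb Y ` topspace Y" .
  moreover have "|idem_supp (stone_cech Y) ?\<nu>| <o \<tau>"
    using ordLeq_ordLess_trans[OF ordLeq_transitive[OF card_of_mono1[OF supp] card_of_image] \<mu>'(3)] .
  ultimately show ?thesis
    using supp idem_map_in_idem_measures[OF h \<mu>'(1)]
    unfolding Ibeta_map_apply[OF \<mu>] in_topspace_Itau_iff by blast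
qed

lemma continuous_Itau_map:
  assumes f: "continuous_map X Y f"
  shows "continuous_map (Itau \<tau> X) (Itau \<tau> Y) (Itau_map \<tau> X Y f)"
proof -
  let ?I = "idem_map (stone_cech X) (stone_cech Y) (stone_cech_map X Y f)"
  have Itau: "Itau \<tau> Z = subtopology (idem_space (stone_cech Z)) (topspace (Itau \<tau> Z))" for Z :: "'z topology"
    unfolding Itau_def Ibeta_def subtopology_subtopology by (simp add: subtopology_restrict Int_ac)
  have "continuous_map (Itau \<tau> X) (idem_space (stone_cech Y)) ?I"
    using continuous_map_idem_map[OF continuous_stone_cech_map[OF f]]
    by (subst Itau) (rule continuous_map_from_subtopology)
  moreover have eq: "Itau_map \<tau> X Y f \<mu> = ?I \<mu>" if "\<mu> \<in> topspace (Itau \<tau> X)" for \<mu>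
    using that by (simp add: Itau_map_apply Ibeta_map_apply)
  ultimately have "continuous_map (Itau \<tau> X) (idem_space (stone_cech Y)) (Itau_map \<tau> X Y f)"
    by (rule continuous_map_eq[OF _ sym])
  then show ?thesis
    using Ibeta_map_in_Itau[OF f]
    by (subst Itau[of Y]) (auto simp: continuous_map_in_subtopology Itau_map_apply)
qed

lemma Itau_map_id: "Itau_map \<tau> X X (\<lambda>x. x) = (\<lambda>\<mu>\<in>topspace (Itau \<tau> X). \<mu>)"
proof
  fix \<mu> show "Itau_map \<tau> X X (\<lambda>x. x) \<mu> = (\<lambda>\<mu>\<in>topspace (Itau \<tau> X). \<mu>) \<mu>"
  proof (cases "\<mu> \<in> topspace (Itau \<tau> X)")
    case True
    then have "idem_map (stone_cech X) (stone_cech X) (stone_cech_map X X (\<lambda>x. x)) \<mu> = \<mu>"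
      by (intro idem_map_id) (simp_all add: in_topspace_Itau_iff stone_cech_map_id)
    with True show ?thesis by (simp add: Itau_map_apply Ibeta_map_apply)
  qed (simp add: Itau_map_def)
qed

lemma Itau_map_compose:
  assumes f: "continuous_map X Y f" and g: "continuous_map Y Z g"
  shows "Itau_map \<tau> X Z (g \<circ> f)
    = compose (topspace (Itau \<tau> X)) (Itau_map \<tau> Y Z g) (Itau_map \<tau> X Y f)"
proof
  fix \<mu> show "Itau_map \<tau> X Z (g \<circ> f) \<mu>
    = compose (topspace (Itau \<tau> X)) (Itau_map \<tau> Y Z g) (Itau_map \<tau> X Y f) \<mu>"
  proof (cases "\<mu> \<in> topspace (Itau \<tau> X)")
    case True
    note \<nu> = Ibeta_map_in_Itau[OF f True]
    have "Itau_map \<tau> X Z (g \<circ> f) \<mu>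
        = idem_map (stone_cech Y) (stone_cech Z) (stone_cech_map Y Z g)
            (idem_map (stone_cech X) (stone_cech Y) (stone_cech_map X Y f) \<mu>)"
      using True
      by (simp add: Itau_map_apply Ibeta_map_apply stone_cech_map_compose[OF f g]
          idem_map_compose[OF continuous_stone_cech_map[OF f] continuous_stone_cech_map[OF g]])
    also have "\<dots> = Itau_map \<tau> Y Z g (Itau_map \<tau> X Y f \<mu>)"
      unfolding Itau_map_apply[OF True] Itau_map_apply[OF \<nu>] Ibeta_map_apply[OF \<nu>]
      by (simp only: Ibeta_map_apply[OF True])
    finally show ?thesis using True by (simp add: compose_def)
  qed (simp add: Itau_map_def compose_def)
qed

text \<open>Infiniteness of \<open>\<tau>\<close> is what keeps the union of two supports below \<open>\<tau>\<close>.\<close>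

lemma max_plus_convex_Itau:
  assumes \<tau>: "Cinfinite \<tau>"
  shows "max_plus_convex (stone_cech X) (topspace (Itau \<tau> X))"
  unfolding max_plus_convex_def
proof (intro ballI impI)
  fix \<mu> \<nu> a b
  assume \<mu>: "\<mu> \<in> topspace (Itau \<tau> X)" and \<nu>: "\<nu> \<in> topspace (Itau \<tau> X)" and ab: "max a b = (0 :: ereal)"
  let ?K = "stone_cech X" and ?\<kappa> = "max_plus_comb (stone_cech X) a \<mu> b \<nu>"
  have supp: "idem_supp ?K ?\<kappa> \<subseteq> idem_supp ?K \<mu> \<union> idem_supp ?K \<nu>"
    using \<mu> \<nu> ab
    by (intro idem_supp_max_plus_comb compact_space_stone_cech Hausdorff_space_stone_cech)
      (simp_all add: in_topspace_Itau_iff)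
  have "|idem_supp ?K \<mu> \<union> idem_supp ?K \<nu>| <o \<tau>"
    using \<mu> \<nu> \<tau> by (intro Un_Cinfinite_bound_strict) (simp_all add: in_topspace_Itau_iff)
  then have "|idem_supp ?K ?\<kappa>| <o \<tau>"
    by (rule ordLeq_ordLess_trans[OF card_of_mono1[OF supp]])
  then show "?\<kappa> \<in> topspace (Itau \<tau> X)"
    using supp \<mu> \<nu> max_plus_comb_in_idem_measures[of \<mu> ?K \<nu>, OF _ _ ab]
    unfolding in_topspace_Itau_iff by blast
qed

theorem theorem4:
  fixes \<tau> :: "'t rel"
    and X :: "'a topology" and Y :: "'b topology" and Z :: "'c topology"
  assumes "Cinfinite \<tau>"
    and "tychonoff_space X" and "tychonoff_space Y" and "tychonoff_space Z"
  shows "tychonoff_space (Itau \<tau> X) \<and>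
    (\<exists>S \<subseteq> topspace (Ibeta X). Itau \<tau> X = subtopology (Ibeta X) S) \<and>
    (\<forall>f. continuous_map X Y f \<longrightarrow>
       Ibeta_map X Y f ` topspace (Itau \<tau> X) \<subseteq> topspace (Itau \<tau> Y) \<and>
       continuous_map (Itau \<tau> X) (Itau \<tau> Y) (Itau_map \<tau> X Y f) \<and>
       (\<forall>\<mu>\<in>topspace (Itau \<tau> X). Itau_map \<tau> X Y f \<mu> = Ibeta_map X Y f \<mu>)) \<and>
    Itau_map \<tau> X X (\<lambda>x. x) = (\<lambda>\<mu>\<in>topspace (Itau \<tau> X). \<mu>) \<and>
    (\<forall>f g. continuous_map X Y f \<longrightarrow> continuous_map Y Z g \<longrightarrow>
       Itau_map \<tau> X Z (g \<circ> f) =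
         compose (topspace (Itau \<tau> X)) (Itau_map \<tau> Y Z g) (Itau_map \<tau> X Y f)) \<and>
    max_plus_convex (stone_cech X) (topspace (Itau \<tau> X))"
proof (intro conjI allI impI ballI)
  show "tychonoff_space (Itau \<tau> X)"
    by (rule tychonoff_Itau)
  have "Itau \<tau> X = subtopology (Ibeta X) (topspace (Itau \<tau> X))"
    unfolding Itau_def by (simp only: topspace_subtopology subtopology_restrict)
  moreover have "topspace (Itau \<tau> X) \<subseteq> topspace (Ibeta X)"
    unfolding Itau_def by simp
  ultimately show "\<exists>S\<subseteq>topspace (Ibeta X). Itau \<tau> X = subtopology (Ibeta X) S"
    by blast
next
  fix f assume "continuous_map X Y f"
  then show "Ibeta_map X Y f ` topspace (Itau \<tau> X) \<subseteq> topspace (Itau \<tau> Y)"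
    using Ibeta_map_in_Itau by blast
next
  show "max_plus_convex (stone_cech X) (topspace (Itau \<tau> X))"
    by (rule max_plus_convex_Itau[OF assms(1)])
qed (auto intro: continuous_Itau_map Itau_map_apply Itau_map_id Itau_map_compose)

end
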